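(* Let $X$ be a Banach space containing an isomorphic copy of $c_0$ (that is, $X$ has a closed subspace linearly homeomorphic to $c_0$). Then there exists an equivalent norm on $X$ such that $X$ is an almost square (ASQ) space under the new norm.
   Context: All Banach spaces are real. $S_X$ denotes the unit sphere of a Banach space $X$. A Banach space $X$ is almost square (ASQ) if for every finite collection $x_1,\ldots,x_k\in S_X$ there exists a sequence $\{y_m\}_m$ in $S_X$ such that $\|y_m\|\to 1$ and $\|x_i\pm y_m\|\to 1$ as $m\to\infty$ (for both choices of sign) for every $i\in\{1,\ldots,k\}$. *)

theory Defs
  imports "HOL-Analysis.Analysis"
begin

text \<open>
  The topology of the type \<open>nat\<close> is discrete, so \<open>nat \<Rightarrow>\<^sub>C real\<close> is the space of all
  bounded real sequences with the supremum norm, and \<open>c0\<close> is a subspace of it.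
\<close>

definition c0 :: "(nat \<Rightarrow>\<^sub>C real) set" where
  "c0 = {f. apply_bcontfun f \<longlonglongrightarrow> 0}"

text \<open>
  Intended for linear subspaces \<open>S\<close> and \<open>T\<close>. Linearity is relativised to \<open>S\<close>, because the
  values of the homeomorphism outside \<open>S\<close> are irrelevant.
\<close>

definition linearly_homeomorphic ::
    "'a::real_normed_vector set \<Rightarrow> 'b::real_normed_vector set \<Rightarrow> bool" where
  "linearly_homeomorphic S T \<longleftrightarrow>
    (\<exists>f g. homeomorphism S T f g \<and>
      (\<forall>x\<in>S. \<forall>y\<in>S. f (x + y) = f x + f y) \<and>
      (\<forall>c. \<forall>x\<in>S. f (c *\<^sub>R x) = c *\<^sub>R f x))"

definition is_norm :: "('a::real_vector \<Rightarrow> real) \<Rightarrow> bool" where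
  "is_norm p \<longleftrightarrow>
    (\<forall>x. p x = 0 \<longleftrightarrow> x = 0) \<and>
    (\<forall>x y. p (x + y) \<le> p x + p y) \<and>
    (\<forall>c x. p (c *\<^sub>R x) = \<bar>c\<bar> * p x)"

definition equivalent_norm :: "('a::real_normed_vector \<Rightarrow> real) \<Rightarrow> bool" where
  "equivalent_norm p \<longleftrightarrow>
    is_norm p \<and> (\<exists>a>0. \<exists>b>0. \<forall>x. a * norm x \<le> p x \<and> p x \<le> b * norm x)"

text \<open>
  The norm is an explicit argument, since the property is needed for a norm other than the one
  of the type class. For \<open>k = 0\<close> the condition only says that the unit sphere is nonempty.
\<close>

definition almost_square :: "('a::real_vector \<Rightarrow> real) \<Rightarrow> bool" where
  "almost_square p \<longleftrightarrow>
    (\<forall>(k::nat) x. (\<forall>i\<in>{1..k}. p (x i) = 1) \<longrightarrow>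
      (\<exists>y::nat \<Rightarrow> 'a. (\<forall>m. p (y m) = 1) \<and>
        (\<lambda>m. p (y m)) \<longlonglongrightarrow> 1 \<and>
        (\<forall>i\<in>{1..k}. (\<lambda>m. p (x i + y m)) \<longlonglongrightarrow> 1 \<and> (\<lambda>m. p (x i - y m)) \<longlonglongrightarrow> 1)))"

end

theory Submission
  imports Defs
begin

text \<open>
  The model case is \<open>X = Y \<oplus> Z\<close> with \<open>Y\<close> isometric to \<open>c\<^sub>0\<close> and the maximum norm on the sum: far
  unit vectors \<open>e n\<close> of \<open>c\<^sub>0\<close> meet only negligible coordinates of finitely many given vectors, so
  adding \<open>\<plusminus> e n\<close> does not increase their norm beyond \<open>1 + \<epsilon>\<close>. In general \<open>Y\<close> is not complemented, and
  the two halves of that norm are replaced by \<open>p x = max (infdist x Y) (SUP n. \<bar>g n x\<bar>)\<close>, with bounded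
  functionals \<open>g n\<close> on all of \<open>X\<close> that restrict to the coordinates of \<open>Y\<close>.

  The distance to \<open>Y\<close> and the coordinates together control the original norm: a vector close to \<open>Y\<close> is,
  up to a small error, an element of \<open>Y\<close> with small coordinates. The distance does not see \<open>e n\<close>,
  and the only coordinate that does is \<open>g n\<close>. So \<open>p\<close> is almost square as soon as, for every finite set
  \<open>A\<close> and every \<open>\<epsilon> > 0\<close>, some \<open>g n\<close> is smaller than \<open>\<epsilon>\<close> on \<open>A\<close>, that is, as soon as 0 is a weak-*
  cluster point of the \<open>g n\<close> (\<open>almost_square_renorming\<close>).

  Arbitrary Hahn--Banach extensions \<open>h n\<close> of the coordinates need not cluster at 0. But they are
  uniformly bounded, hence converge pointwise along some filter finer than \<open>sequentially\<close> to a
  functional \<open>h'\<close>, by Tychonoff's theorem (\<open>pointwise_bounded_imp_convergent_subfilter\<close>). On \<open>Y\<close> the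
  coordinates tend to 0, so \<open>h'\<close> vanishes there, and \<open>g n = h n - h'\<close> still restricts to the
  coordinates of \<open>Y\<close> while tending to 0 along the filter.
\<close>

section \<open>The Hahn--Banach theorem\<close>

text \<open>
  Homogeneity is required only for \<open>t > 0\<close>, which is what infima of families preserve directly; the
  case \<open>t = 0\<close> follows.
\<close>

definition sublinear :: "('a::real_vector \<Rightarrow> real) \<Rightarrow> bool" where
  "sublinear q \<longleftrightarrow>
    (\<forall>x y. q (x + y) \<le> q x + q y) \<and> (\<forall>t>0. \<forall>x. q (t *\<^sub>R x) = t * q x)"

lemma sublinear_add: "sublinear q \<Longrightarrow> q (x + y) \<le> q x + q y"
  and sublinear_scale: "sublinear q \<Longrightarrow> t > 0 \<Longrightarrow> q (t *\<^sub>R x) = t * q x"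
  by (auto simp: sublinear_def)

lemma sublinear_0:
  assumes "sublinear q" shows "q 0 = 0"
  using sublinear_scale[OF assms, of 2 0] by simp

lemma sublinear_scale_nonneg:
  assumes "sublinear q" "t \<ge> 0" shows "q (t *\<^sub>R x) = t * q x"
  using assms sublinear_0[OF assms(1)] sublinear_scale[OF assms(1), of t x] by (cases "t = 0") auto

text \<open>
  The lower boundary of a convex cone \<open>R\<close> in \<open>X \<times> \<real>\<close> is sublinear. It is finite
  because \<open>R x r\<close> and \<open>R (- x) s\<close> give \<open>R 0 (r + s)\<close>, hence \<open>- s \<le> r\<close>. Every infimum that the
  Hahn--Banach argument forms is of this kind.
\<close>

lemma sublinear_lower_envelope:
  fixes R :: "'a::real_vector \<Rightarrow> real \<Rightarrow> bool"
  assumes add: "\<And>x y r s. R x r \<Longrightarrow> R y s \<Longrightarrow> R (x + y) (r + s)"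
    and scale: "\<And>x r t. R x r \<Longrightarrow> t > 0 \<Longrightarrow> R (t *\<^sub>R x) (t * r)"
    and ex: "\<And>x. \<exists>r. R x r"
    and nonneg: "\<And>r. R 0 r \<Longrightarrow> 0 \<le> r"
  obtains q where "sublinear q" "\<And>x r. R x r \<Longrightarrow> q x \<le> r"
proof -
  define q where "q x = Inf {r. R x r}" for x
  have bdd: "bdd_below {r. R x r}" for x
  proof -
    obtain s where s: "R (- x) s" using ex by blast
    have "- s \<le> r" if "R x r" for r
      using nonneg[of "r + s"] add[OF that s] by simp
    then show ?thesis by (intro bdd_belowI[of _ "- s"]) auto
  qed
  have lower: "q x \<le> r" if "R x r" for x r
    unfolding q_def using that by (auto intro: cInf_lower bdd)
  have greatest: "c \<le> q x" if "\<And>r. R x r \<Longrightarrow> c \<le> r" for c x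
    unfolding q_def using that ex[of x] by (auto intro: cInf_greatest)
  have "q (x + y) \<le> q x + q y" for x y
  proof -
    have "q (x + y) - s \<le> r" if "R x r" "R y s" for r s
      using lower[OF add[OF that]] by simp
    then have "q (x + y) - s \<le> q x" if "R y s" for s
      using that by (blast intro: greatest)
    then have "q (x + y) - q x \<le> q y"
      by (intro greatest) (simp add: algebra_simps)
    then show ?thesis by simp
  qed
  moreover have scale_le: "q (t *\<^sub>R x) \<le> t * q x" if "t > 0" for t x
  proof -
    have "q (t *\<^sub>R x) / t \<le> r" if "R x r" for r
      using lower[OF scale[OF that \<open>t > 0\<close>]] \<open>t > 0\<close> by (simp add: field_simps)
    then have "q (t *\<^sub>R x) / t \<le> q x" by (rule greatest)
    then show ?thesis using that by (simp add: field_simps)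
  qed
  moreover have "t * q x \<le> q (t *\<^sub>R x)" if "t > 0" for t x
    using scale_le[of "inverse t" "t *\<^sub>R x"] that by (simp add: field_simps)
  ultimately have "sublinear q"
    unfolding sublinear_def by (auto intro: antisym)
  then show thesis using lower that by blast
qed

text \<open>
  For each direction \<open>y\<close> the functional \<open>q' x = (INF t\<in>{0..}. q (x + t y) - t q y)\<close> is sublinear and below
  \<open>q\<close> (take \<open>t = 0\<close>), so it equals \<open>q\<close> by minimality. Then \<open>t = 1\<close> gives \<open>q x \<le> q (x + y) - q y\<close>, the
  reverse of subadditivity.
\<close>

lemma linear_of_minimal_sublinear:
  fixes q :: "'a::real_vector \<Rightarrow> real"
  assumes q: "sublinear q"
    and minimal: "\<And>q'. sublinear q' \<Longrightarrow> (\<And>x. q' x \<le> q x) \<Longrightarrow> q' = q"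
  shows "linear q"
proof -
  have superadd: "q x + q y \<le> q (x + y)" for x y
  proof -
    define R where "R = (\<lambda>x r. \<exists>t\<ge>0. q (x + t *\<^sub>R y) - t * q y \<le> r)"
    obtain q' where q': "sublinear q'" "\<And>x r. R x r \<Longrightarrow> q' x \<le> r"
    proof (rule sublinear_lower_envelope[of R])
      fix x z r s assume "R x r" "R z s"
      then obtain t u where tu: "t \<ge> 0" "u \<ge> 0"
        "q (x + t *\<^sub>R y) - t * q y \<le> r" "q (z + u *\<^sub>R y) - u * q y \<le> s"
        unfolding R_def by blast
      have "q ((x + z) + (t + u) *\<^sub>R y) \<le> q (x + t *\<^sub>R y) + q (z + u *\<^sub>R y)"
        using sublinear_add[OF q, of "x + t *\<^sub>R y" "z + u *\<^sub>R y"] by (simp add: algebra_simps)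
      with tu show "R (x + z) (r + s)"
        unfolding R_def by (intro exI[of _ "t + u"]) (auto simp: algebra_simps)
    next
      fix x r c assume "R x r" and c: "c > (0::real)"
      then obtain t where t: "t \<ge> 0" "q (x + t *\<^sub>R y) - t * q y \<le> r"
        unfolding R_def by blast
      have "q (c *\<^sub>R x + (c * t) *\<^sub>R y) = c * q (x + t *\<^sub>R y)"
        using sublinear_scale[OF q c, of "x + t *\<^sub>R y"] by (simp add: algebra_simps)
      then have "q (c *\<^sub>R x + (c * t) *\<^sub>R y) - c * t * q y = c * (q (x + t *\<^sub>R y) - t * q y)"
        by (simp add: algebra_simps)
      also have "\<dots> \<le> c * r" using t c by (intro mult_left_mono) auto
      finally show "R (c *\<^sub>R x) (c * r)"
        unfolding R_def using t c by (intro exI[of _ "c * t"]) auto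
    next
      show "\<exists>r. R x r" for x unfolding R_def by (meson order_refl)
      show "0 \<le> r" if "R 0 r" for r
        using that sublinear_scale_nonneg[OF q] unfolding R_def by auto
    qed blast
    have "R x (q x)" for x unfolding R_def by (intro exI[of _ 0]) auto
    then have "q' = q" using q' by (intro minimal) auto
    moreover have "R x (q (x + y) - q y)" unfolding R_def by (intro exI[of _ 1]) auto
    ultimately show ?thesis using q'(2) by fastforce
  qed
  have add: "q (x + y) = q x + q y" for x y
    using superadd sublinear_add[OF q] by (simp add: antisym)
  have minus: "q (- x) = - q x" for x
    using add[of x "- x"] sublinear_0[OF q] by simp
  have "q (c *\<^sub>R x) = c * q x" for c x
    using sublinear_scale_nonneg[OF q, of c x] sublinear_scale_nonneg[OF q, of "- c" x]
      minus[of "c *\<^sub>R x"]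
    by (cases "c \<ge> 0") auto
  with add show ?thesis by (intro linearI) auto
qed

text \<open>
  Zorn's lemma for sublinear functionals ordered downwards: a chain has its pointwise infimum as a
  bound, since the union of the epigraphs of a chain is a convex cone. All functionals are total, so
  no partially defined extensions have to be compared.
\<close>

lemma ex_linear_le_sublinear:
  fixes p :: "'a::real_vector \<Rightarrow> real"
  assumes p: "sublinear p"
  obtains h where "linear h" "\<And>x. h x \<le> p x"
proof -
  define A where "A = {q. sublinear q \<and> (\<forall>x. q x \<le> p x)}"
  define P where "P = (\<lambda>q q' :: 'a \<Rightarrow> real. q' \<le> q)"
  have "\<exists>m\<in>A. \<forall>a\<in>A. P m a \<longrightarrow> a = m"
  proof (rule predicate_Zorn)
    show "partial_order_on A (relation_of P A)"
      unfolding P_def by (intro partial_order_on_relation_ofI) auto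
  next
    fix C assume "C \<in> Chains (relation_of P A)"
    then have CA: "C \<subseteq> A" and chain: "\<And>q q'. q \<in> C \<Longrightarrow> q' \<in> C \<Longrightarrow> q \<le> q' \<or> q' \<le> q"
      unfolding Chains_def relation_of_def P_def by blast+
    show "\<exists>u\<in>A. \<forall>a\<in>C. P a u"
    proof (cases "C = {}")
      case True
      then show ?thesis using p by (auto simp: A_def)
    next
      case False
      have C: "sublinear q" "q x \<le> p x" if "q \<in> C" for q x
        using that CA by (auto simp: A_def)
      define R where "R = (\<lambda>x r. \<exists>q\<in>C. q x \<le> r)"
      obtain u where u: "sublinear u" "\<And>x r. R x r \<Longrightarrow> u x \<le> r"
      proof (rule sublinear_lower_envelope[of R])
        fix x y r s assume "R x r" "R y s"
        then obtain q q' where "q \<in> C" "q' \<in> C" "q x \<le> r" "q' y \<le> s"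
          unfolding R_def by blast
        moreover from this obtain q'' where "q'' \<in> C" "q'' \<le> q" "q'' \<le> q'"
          using chain by blast
        ultimately have "q'' x \<le> r" "q'' y \<le> s" "q'' \<in> C"
          by (auto simp: le_fun_def intro: order_trans)
        then show "R (x + y) (r + s)"
          unfolding R_def using sublinear_add[OF C(1), of q'' x y] by (intro bexI[of _ q'']) auto
      next
        fix x r t assume "R x r" "t > (0::real)"
        then obtain q where "q \<in> C" "q x \<le> r" unfolding R_def by blast
        then show "R (t *\<^sub>R x) (t * r)"
          unfolding R_def using sublinear_scale[OF C(1), of q t x] \<open>t > 0\<close>
          by (intro bexI[of _ q]) (simp_all add: mult_left_mono)
      next
        show "\<exists>r. R x r" for x using False unfolding R_def by blast
        show "0 \<le> r" if "R 0 r" for r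
          using that sublinear_0[OF C(1)] unfolding R_def by fastforce
      qed blast
      have le: "u x \<le> q x" if "q \<in> C" for q x
        using u(2) that unfolding R_def by blast
      then have "u \<in> A" using u(1) False C(2) unfolding A_def by (blast intro: order_trans)
      then show ?thesis using le unfolding P_def by (auto simp: le_fun_def)
    qed
  qed
  then obtain m where m: "m \<in> A" "\<And>a. a \<in> A \<Longrightarrow> a \<le> m \<Longrightarrow> a = m"
    unfolding P_def by blast
  have "linear m"
  proof (rule linear_of_minimal_sublinear)
    show "sublinear m" using m by (simp add: A_def)
    show "q' = m" if "sublinear q'" "\<And>x. q' x \<le> m x" for q'
      using that m(1) by (intro m(2)) (auto simp: A_def le_fun_def intro: order_trans)
  qed
  then show thesis using m(1) that by (auto simp: A_def)
qed

text \<open>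
  The functional \<open>q x = (INF y\<in>Y. p (x - y) + g y)\<close> is sublinear, lies below \<open>p\<close>, and lies below \<open>g\<close> on \<open>Y\<close>.
  A linear \<open>h\<close> below \<open>q\<close> therefore satisfies \<open>h \<le> g\<close> on \<open>Y\<close>, and applying this to \<open>- y\<close> turns the
  inequality into equality.
\<close>

theorem hahn_banach:
  fixes p :: "'a::real_vector \<Rightarrow> real"
  assumes Y: "subspace Y" and p: "sublinear p"
    and g_add: "\<And>x y. x \<in> Y \<Longrightarrow> y \<in> Y \<Longrightarrow> g (x + y) = g x + g y"
    and g_scale: "\<And>c x. x \<in> Y \<Longrightarrow> g (c *\<^sub>R x) = c * g x"
    and g_le: "\<And>y. y \<in> Y \<Longrightarrow> g y \<le> p y"
  obtains h where "linear h" "\<And>y. y \<in> Y \<Longrightarrow> h y = g y" "\<And>x. h x \<le> p x"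
proof -
  have g_minus: "g (- y) = - g y" if "y \<in> Y" for y
    using g_scale[OF that, of "- 1"] by simp
  have g0: "g 0 = 0" using g_scale[of 0 0] subspace_0[OF Y] by simp
  define R where "R = (\<lambda>x r. \<exists>y\<in>Y. p (x - y) + g y \<le> r)"
  obtain q where q: "sublinear q" "\<And>x r. R x r \<Longrightarrow> q x \<le> r"
  proof (rule sublinear_lower_envelope[of R])
    fix x z r s assume "R x r" "R z s"
    then obtain y w where yw: "y \<in> Y" "w \<in> Y" "p (x - y) + g y \<le> r" "p (z - w) + g w \<le> s"
      unfolding R_def by blast
    have "p ((x + z) - (y + w)) \<le> p (x - y) + p (z - w)"
      using sublinear_add[OF p, of "x - y" "z - w"] by (simp add: algebra_simps)
    with yw show "R (x + z) (r + s)"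
      unfolding R_def using subspace_add[OF Y] g_add by (intro bexI[of _ "y + w"]) auto
  next
    fix x r t assume "R x r" and t: "t > (0::real)"
    then obtain y where y: "y \<in> Y" "p (x - y) + g y \<le> r"
      unfolding R_def by blast
    have "p (t *\<^sub>R x - t *\<^sub>R y) = t * p (x - y)"
      using sublinear_scale[OF p t, of "x - y"] by (simp add: algebra_simps)
    then have "p (t *\<^sub>R x - t *\<^sub>R y) + g (t *\<^sub>R y) = t * (p (x - y) + g y)"
      using g_scale[OF y(1)] by (simp add: algebra_simps)
    also have "\<dots> \<le> t * r" using y t by (intro mult_left_mono) auto
    finally show "R (t *\<^sub>R x) (t * r)"
      unfolding R_def using subspace_scale[OF Y y(1)] by blast
  next
    show "\<exists>r. R x r" for x unfolding R_def using subspace_0[OF Y] by blast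
    show "0 \<le> r" if R: "R 0 r" for r
    proof -
      obtain y where y: "y \<in> Y" "p (- y) + g y \<le> r" using R unfolding R_def by auto
      then show ?thesis using g_le[of "- y"] g_minus[of y] subspace_neg[OF Y] by simp
    qed
  qed blast
  obtain h where h: "linear h" "\<And>x. h x \<le> q x"
    using ex_linear_le_sublinear[OF q(1)] by blast
  have h_le_g: "h y \<le> g y" if "y \<in> Y" for y
  proof -
    have "R y (g y)" unfolding R_def using that sublinear_0[OF p] by (intro bexI[of _ y]) auto
    then show ?thesis using q(2) h(2) order_trans by blast
  qed
  show thesis
  proof
    show "linear h" by fact
    show "h y = g y" if "y \<in> Y" for y
      using h_le_g[OF that] h_le_g[of "- y"] subspace_neg[OF Y that] g_minus[OF that]
        linear_neg[OF h(1), of y] by simp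
    show "h x \<le> p x" for x
    proof -
      have "R x (p x)" unfolding R_def using subspace_0[OF Y] g0 by (intro bexI[of _ 0]) auto
      then show ?thesis using q(2) h(2) order_trans by blast
    qed
  qed
qed

corollary hahn_banach_norm:
  fixes Y :: "'a::real_normed_vector set"
  assumes Y: "subspace Y" and "C \<ge> 0"
    and g_add: "\<And>x y. x \<in> Y \<Longrightarrow> y \<in> Y \<Longrightarrow> g (x + y) = g x + g y"
    and g_scale: "\<And>c x. x \<in> Y \<Longrightarrow> g (c *\<^sub>R x) = c * g x"
    and g_le: "\<And>y. y \<in> Y \<Longrightarrow> \<bar>g y\<bar> \<le> C * norm y"
  obtains h where "linear h" "\<And>y. y \<in> Y \<Longrightarrow> h y = g y" "\<And>x. \<bar>h x\<bar> \<le> C * norm x"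
proof -
  have "sublinear (\<lambda>x::'a. C * norm x)"
    unfolding sublinear_def using \<open>C \<ge> 0\<close>
    by (auto simp: mult_left_mono norm_triangle_ineq simp flip: distrib_left)
  then obtain h where h: "linear h" "\<And>y. y \<in> Y \<Longrightarrow> h y = g y" "\<And>x. h x \<le> C * norm x"
  proof (rule hahn_banach[OF Y _ g_add g_scale])
    show "g y \<le> C * norm y" if "y \<in> Y" for y using g_le[OF that] by simp
  qed auto
  have "\<bar>h x\<bar> \<le> C * norm x" for x
    using h(3)[of x] h(3)[of "- x"] linear_neg[OF h(1), of x] by (simp add: abs_le_iff)
  with h that show thesis by blast
qed

section \<open>Pointwise cluster points\<close>

text \<open>
  All \<open>f n\<close> lie in a product of compact intervals, so they have a cluster point \<open>h\<close> in the product
  topology. A pointwise convergent subsequence need not exist when the domain is uncountable; the filter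
  \<open>G\<close> of indices whose functions are close to \<open>h\<close> takes its place and makes the usual limit laws
  available.
\<close>

lemma pointwise_bounded_imp_convergent_subfilter:
  fixes f :: "nat \<Rightarrow> 'a \<Rightarrow> real"
  assumes bound: "\<And>n x. \<bar>f n x\<bar> \<le> b x"
  obtains G h where "G \<le> sequentially" "G \<noteq> bot" "\<And>x. ((\<lambda>n. f n x) \<longlongrightarrow> h x) G"
proof -
  let ?K = "\<Pi>\<^sub>E x\<in>UNIV. {- b x..b x}"
  have "compactin (product_topology (\<lambda>x. euclidean) UNIV) ?K"
    by (subst compactin_PiE) auto
  then have "compact ?K"
    by (simp add: euclidean_product_topology)
  moreover have "eventually (\<lambda>g. g \<in> ?K) (filtermap f sequentially)"
  proof -
    have "f n \<in> ?K" for n using bound[of n] by (simp add: PiE_iff abs_le_iff minus_le_iff)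
    then show ?thesis by (simp add: eventually_filtermap)
  qed
  moreover have "filtermap f sequentially \<noteq> bot"
    by (simp add: filtermap_bot_iff)
  ultimately obtain h where h: "inf (nhds h) (filtermap f sequentially) \<noteq> bot"
    unfolding compact_filter by blast
  define G where "G = inf sequentially (filtercomap f (nhds h))"
  show thesis
  proof
    show "G \<le> sequentially" by (simp add: G_def)
    show "G \<noteq> bot"
    proof
      assume "G = bot"
      then obtain P Q where PQ: "eventually P sequentially" "eventually Q (nhds h)"
        "\<And>n. P n \<Longrightarrow> Q (f n) \<Longrightarrow> False"
        unfolding G_def trivial_limit_def eventually_inf eventually_filtercomap by blast
      then have "eventually (\<lambda>g. \<not> Q g) (filtermap f sequentially)"
        unfolding eventually_filtermap by (metis (mono_tags, lifting) eventually_mono)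
      with PQ(2) have "inf (nhds h) (filtermap f sequentially) = bot"
        unfolding trivial_limit_def eventually_inf by blast
      with h show False by blast
    qed
    have "filterlim f (nhds h) G"
      unfolding G_def by (intro filterlim_mono[OF filterlim_filtercomap]) auto
    then show "((\<lambda>n. f n x) \<longlongrightarrow> h x) G" for x
      by (rule continuous_on_tendsto_compose[OF continuous_on_product_coordinates]) auto
  qed
qed

lemma linear_of_pointwise_limit:
  fixes f :: "'i \<Rightarrow> 'a::real_vector \<Rightarrow> real"
  assumes "G \<noteq> bot" and lim: "\<And>x. ((\<lambda>n. f n x) \<longlongrightarrow> h x) G" and f: "\<And>n. linear (f n)"
  shows "linear h"
proof (rule linearI)
  fix x y
  have "((\<lambda>n. f n (x + y)) \<longlongrightarrow> h x + h y) G"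
    using tendsto_add[OF lim[of x] lim[of y]] by (simp add: linear_add[OF f])
  then show "h (x + y) = h x + h y" using lim \<open>G \<noteq> bot\<close> tendsto_unique by blast
next
  fix c x
  have "((\<lambda>n. f n (c *\<^sub>R x)) \<longlongrightarrow> c * h x) G"
    using tendsto_mult_left[OF lim[of x], of c] by (simp add: linear_scale[OF f])
  then have "h (c *\<^sub>R x) = c * h x" using lim \<open>G \<noteq> bot\<close> tendsto_unique by blast
  then show "h (c *\<^sub>R x) = c *\<^sub>R h x" by simp
qed

section \<open>Coordinates on a copy of c0\<close>

lemma linear_on_bounded:
  fixes f :: "'a::real_normed_vector \<Rightarrow> 'b::real_normed_vector"
  assumes S: "subspace S" and cont: "continuous_on S f"
    and scale: "\<And>c x. x \<in> S \<Longrightarrow> f (c *\<^sub>R x) = c *\<^sub>R f x"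
  obtains C where "C > 0" "\<And>x. x \<in> S \<Longrightarrow> norm (f x) \<le> C * norm x"
proof -
  have f0: "f 0 = 0" using scale[of 0 0] subspace_0[OF S] by simp
  obtain d where d: "d > 0" "\<And>x. x \<in> S \<Longrightarrow> norm x < d \<Longrightarrow> norm (f x) < 1"
    using cont[unfolded continuous_on_iff, rule_format, of 0 1] subspace_0[OF S] f0
    by (auto simp: dist_norm)
  have "norm (f x) \<le> 2 / d * norm x" if x: "x \<in> S" for x
  proof (cases "x = 0")
    case False
    define c where "c = d / (2 * norm x)"
    have c: "c > 0" using d False by (simp add: c_def)
    have "norm (f (c *\<^sub>R x)) < 1"
      using d(1) False c by (intro d(2) subspace_scale[OF S x]) (simp add: c_def)
    then have "c * norm (f x) < 1" using scale[OF x] c by simp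
    then show ?thesis using d(1) False by (simp add: c_def field_simps)
  qed (simp add: f0)
  then show thesis using d(1) that[of "2 / d"] by auto
qed

lemma subspace_c0: "subspace c0"
  unfolding c0_def
  by (intro subspaceI) (auto intro: tendsto_eq_intros simp: tendsto_add_zero tendsto_mult_right_zero)

text \<open>
  The coordinates of the inverse isomorphism are bounded by a common \<open>C\<close>, and extending each by
  Hahn--Banach keeps that bound; \<open>e\<close> is the image of the unit vector basis. The last conclusion is the
  boundedness of the isomorphism, in terms of coordinates alone.
\<close>

lemma c0_copy_coordinates:
  fixes Y :: "'a::real_normed_vector set"
  assumes Y: "subspace Y" and hom: "linearly_homeomorphic c0 Y"
  obtains e :: "nat \<Rightarrow> 'a" and h :: "nat \<Rightarrow> 'a \<Rightarrow> real" and C K :: real where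
    "K > 0" "\<And>n. linear (h n)" "\<And>n x. \<bar>h n x\<bar> \<le> C * norm x"
    "\<And>n. e n \<in> Y" "\<And>n m. h n (e m) = (if n = m then 1 else 0)"
    "\<And>y. y \<in> Y \<Longrightarrow> (\<lambda>n. h n y) \<longlonglongrightarrow> 0"
    "\<And>y M. y \<in> Y \<Longrightarrow> (\<And>n. \<bar>h n y\<bar> \<le> M) \<Longrightarrow> norm y \<le> K * M"
proof -
  obtain T S where TS: "homeomorphism c0 Y T S"
    and T_add: "\<And>x y. x \<in> c0 \<Longrightarrow> y \<in> c0 \<Longrightarrow> T (x + y) = T x + T y"
    and T_scale: "\<And>c x. x \<in> c0 \<Longrightarrow> T (c *\<^sub>R x) = c *\<^sub>R T x"
    using hom unfolding linearly_homeomorphic_def by blast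
  have T: "T x \<in> Y" "S (T x) = x" if "x \<in> c0" for x
    using TS that by (auto simp: homeomorphism_def)
  have S: "S y \<in> c0" "T (S y) = y" if "y \<in> Y" for y
    using TS that by (auto simp: homeomorphism_def)
  have S_add: "S (x + y) = S x + S y" if "x \<in> Y" "y \<in> Y" for x y
    using T(2)[of "S x + S y"] T_add[of "S x" "S y"] S that subspace_add[OF subspace_c0] by metis
  have S_scale: "S (c *\<^sub>R y) = c *\<^sub>R S y" if "y \<in> Y" for c y
    using T(2)[of "c *\<^sub>R S y"] T_scale[of "S y" c] S that subspace_scale[OF subspace_c0] by metis
  obtain K where K: "K > 0" "\<And>x. x \<in> c0 \<Longrightarrow> norm (T x) \<le> K * norm x"
    using linear_on_bounded[OF subspace_c0 _ T_scale] TS by (auto simp: homeomorphism_def)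
  obtain C where C: "C > 0" "\<And>y. y \<in> Y \<Longrightarrow> norm (S y) \<le> C * norm y"
    using linear_on_bounded[OF Y _ S_scale] TS by (auto simp: homeomorphism_def)
  have "\<exists>h. linear h \<and> (\<forall>y\<in>Y. h y = apply_bcontfun (S y) n) \<and> (\<forall>x. \<bar>h x\<bar> \<le> C * norm x)" for n
  proof -
    have "\<bar>apply_bcontfun (S y) n\<bar> \<le> C * norm y" if "y \<in> Y" for y
      using C(2)[OF that] norm_bounded[of "S y" n] by simp
    then obtain h where "linear h" "\<And>y. y \<in> Y \<Longrightarrow> h y = apply_bcontfun (S y) n"
      "\<And>x. \<bar>h x\<bar> \<le> C * norm x"
      using C(1) hahn_banach_norm[OF Y, of C "\<lambda>y. apply_bcontfun (S y) n"]
      by (auto simp: S_add S_scale)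
    then show ?thesis by blast
  qed
  then obtain h where h: "\<And>n. linear (h n)" "\<And>n y. y \<in> Y \<Longrightarrow> h n y = apply_bcontfun (S y) n"
    "\<And>n x. \<bar>h n x\<bar> \<le> C * norm x" by metis
  define \<delta> :: "nat \<Rightarrow> nat \<Rightarrow>\<^sub>C real" where "\<delta> m = Bcontfun (\<lambda>n. if n = m then 1 else 0)" for m
  have \<delta>: "apply_bcontfun (\<delta> m) n = (if n = m then 1 else 0)" for m n
  proof -
    have "(\<lambda>n. if n = m then 1 else 0 :: real) \<in> bcontfun"
      by (rule bcontfun_normI[of _ 1]) (auto intro: continuous_on_discrete)
    then show ?thesis by (simp add: \<delta>_def Bcontfun_inverse)
  qed
  have \<delta>_c0: "\<delta> m \<in> c0" for m
    unfolding c0_def mem_Collect_eq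
    by (rule tendsto_eventually) (auto simp: \<delta> intro: eventually_mono[OF eventually_gt_at_top[of m]])
  show thesis
  proof (rule that[of K h C "\<lambda>m. T (\<delta> m)"])
    show "h n (T (\<delta> m)) = (if n = m then 1 else 0)" for n m
      using h(2) T \<delta>_c0 \<delta> by simp
    show "(\<lambda>n. h n y) \<longlonglongrightarrow> 0" if "y \<in> Y" for y
      using S(1)[OF that] h(2)[OF that] by (simp add: c0_def)
    show "norm y \<le> K * M" if "y \<in> Y" "\<And>n. \<bar>h n y\<bar> \<le> M" for y M
    proof -
      have "norm (S y) \<le> M"
        using that h(2) by (intro norm_bound) auto
      then show ?thesis
        using K S[OF that(1)] by (metis mult_left_mono order_trans less_imp_le)
    qed
  qed (use K h T \<delta>_c0 in auto)
qed

section \<open>Almost square renormings\<close>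

text \<open>
  Only upper estimates have to be checked: from \<open>2 x = (x + y) + (x - y)\<close> with \<open>p x = 1\<close> it follows that
  \<open>p (x + y) + p (x - y) \<ge> 2\<close>, so an upper bound \<open>1 + \<epsilon>\<close> for one sign gives the lower bound \<open>1 - \<epsilon>\<close> for
  the other.
\<close>

lemma almost_squareI:
  fixes p :: "'a::real_vector \<Rightarrow> real"
  assumes p: "is_norm p"
    and witness: "\<And>A \<epsilon>. finite A \<Longrightarrow> (\<And>x. x \<in> A \<Longrightarrow> p x = 1) \<Longrightarrow> \<epsilon> > 0 \<Longrightarrow>
      \<exists>y. p y = 1 \<and> (\<forall>x\<in>A. p (x + y) \<le> 1 + \<epsilon> \<and> p (x - y) \<le> 1 + \<epsilon>)"
  shows "almost_square p"
  unfolding almost_square_def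
proof (intro allI impI)
  fix k :: nat and x :: "nat \<Rightarrow> 'a"
  assume x: "\<forall>i\<in>{1..k}. p (x i) = 1"
  define \<epsilon> where "\<epsilon> m = inverse (real (Suc m))" for m
  have \<epsilon>: "\<epsilon> m > 0" for m by (simp add: \<epsilon>_def)
  have "\<exists>y. p y = 1 \<and> (\<forall>z\<in>x ` {1..k}. p (z + y) \<le> 1 + \<epsilon> m \<and> p (z - y) \<le> 1 + \<epsilon> m)" for m
    using x \<epsilon> by (intro witness) auto
  then obtain y where y: "\<And>m. p (y m) = 1"
    "\<And>m i. i \<in> {1..k} \<Longrightarrow> p (x i + y m) \<le> 1 + \<epsilon> m"
    "\<And>m i. i \<in> {1..k} \<Longrightarrow> p (x i - y m) \<le> 1 + \<epsilon> m"
    by (metis imageI)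
  have lower: "2 \<le> p (x i + y m) + p (x i - y m)" if "i \<in> {1..k}" for i m
  proof -
    have "2 = p (2 *\<^sub>R x i)"
      using p x that by (simp add: is_norm_def)
    also have "2 *\<^sub>R x i = (x i + y m) + (x i - y m)" by (simp add: scaleR_2)
    also have "p \<dots> \<le> p (x i + y m) + p (x i - y m)"
      using p unfolding is_norm_def by blast
    finally show ?thesis .
  qed
  have to_1: "(\<lambda>m. 1 + \<epsilon> m) \<longlonglongrightarrow> 1" "(\<lambda>m. 1 - \<epsilon> m) \<longlonglongrightarrow> 1"
    using tendsto_add[OF tendsto_const LIMSEQ_inverse_real_of_nat, of "1::real"]
      tendsto_diff[OF tendsto_const LIMSEQ_inverse_real_of_nat, of "1::real"]
    by (simp_all add: \<epsilon>_def)
  have "(\<lambda>m. p (x i + y m)) \<longlonglongrightarrow> 1 \<and> (\<lambda>m. p (x i - y m)) \<longlonglongrightarrow> 1" if i: "i \<in> {1..k}" for i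
  proof
    have "1 - \<epsilon> m \<le> p (x i + y m)" "1 - \<epsilon> m \<le> p (x i - y m)" for m
      using lower[OF i, of m] y(2,3)[OF i, of m] by auto
    then show "(\<lambda>m. p (x i + y m)) \<longlonglongrightarrow> 1" "(\<lambda>m. p (x i - y m)) \<longlonglongrightarrow> 1"
      using y(2,3)[OF i] by (auto intro!: tendsto_sandwich[OF _ _ to_1(2) to_1(1)])
  qed
  then show "\<exists>y. (\<forall>m. p (y m) = 1) \<and> (\<lambda>m. p (y m)) \<longlonglongrightarrow> 1 \<and>
      (\<forall>i\<in>{1..k}. (\<lambda>m. p (x i + y m)) \<longlonglongrightarrow> 1 \<and> (\<lambda>m. p (x i - y m)) \<longlonglongrightarrow> 1)"
    using y(1) by (intro exI[of _ y]) auto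
qed

text \<open>
  The distance to a subspace is the quotient seminorm. Approximation by elements of \<open>Y\<close> is expressed
  with strict inequalities because the infimum need not be attained.
\<close>

lemma infdist_lt_subspace_iff:
  fixes Y :: "'a::real_normed_vector set"
  assumes "subspace Y"
  shows "infdist x Y < r \<longleftrightarrow> (\<exists>y\<in>Y. norm (x - y) < r)"
proof -
  have "Y \<noteq> {}" using subspace_0[OF assms] by blast
  moreover have "bdd_below (dist x ` Y)" by (intro bdd_belowI[of _ 0]) auto
  ultimately show ?thesis by (simp add: infdist_notempty cINF_less_iff dist_norm)
qed

lemma infdist_subspace_add_le:
  fixes Y :: "'a::real_normed_vector set"
  assumes Y: "subspace Y"
  shows "infdist (x + z) Y \<le> infdist x Y + infdist z Y"
proof (rule field_le_epsilon)
  fix \<epsilon> :: real assume "\<epsilon> > 0"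
  then obtain y w where "y \<in> Y" "w \<in> Y" "norm (x - y) < infdist x Y + \<epsilon> / 2"
    "norm (z - w) < infdist z Y + \<epsilon> / 2"
    using infdist_lt_subspace_iff[OF Y, of x "infdist x Y + \<epsilon> / 2"]
      infdist_lt_subspace_iff[OF Y, of z "infdist z Y + \<epsilon> / 2"] by auto
  then have "infdist (x + z) Y < infdist x Y + infdist z Y + \<epsilon>"
    using norm_diff_triangle_ineq[of x z y w] subspace_add[OF Y, of y w]
    by (subst infdist_lt_subspace_iff[OF Y]) (auto intro!: bexI[of _ "y + w"])
  then show "infdist (x + z) Y \<le> infdist x Y + infdist z Y + \<epsilon>" by simp
qed

lemma infdist_subspace_scale:
  fixes Y :: "'a::real_normed_vector set"
  assumes Y: "subspace Y"
  shows "infdist (c *\<^sub>R x) Y = \<bar>c\<bar> * infdist x Y"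
proof -
  have le: "infdist (c *\<^sub>R x) Y \<le> \<bar>c\<bar> * infdist x Y" if "c \<noteq> 0" for c x
  proof (rule dense_ge)
    fix r assume "\<bar>c\<bar> * infdist x Y < r"
    then have "infdist x Y < r / \<bar>c\<bar>" using that by (simp add: field_simps)
    then obtain y where y: "y \<in> Y" "norm (x - y) < r / \<bar>c\<bar>"
      using infdist_lt_subspace_iff[OF Y] by blast
    have "norm (c *\<^sub>R x - c *\<^sub>R y) = \<bar>c\<bar> * norm (x - y)"
      by (simp flip: scaleR_diff_right)
    also have "\<dots> < r" using y that by (simp add: field_simps)
    finally show "infdist (c *\<^sub>R x) Y \<le> r"
      using infdist_lt_subspace_iff[OF Y] subspace_scale[OF Y y(1)] by (meson less_imp_le)
  qed
  show ?thesis
  proof (cases "c = 0")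
    case False
    have "\<bar>c\<bar> * infdist x Y \<le> infdist (c *\<^sub>R x) Y"
      using le[of "inverse c" "c *\<^sub>R x"] False by (simp add: field_simps)
    with le[OF False] show ?thesis by (rule antisym)
  qed (use subspace_0[OF Y] in simp)
qed

text \<open>
  The norm of the model case with the projection onto \<open>Z\<close> replaced by the quotient seminorm. Biorthogonality
  gives \<open>p (e n) = 1\<close>, and \<open>x \<plusminus> e n\<close> differs from \<open>x\<close> only in the coordinate \<open>g n\<close>, which for a suitable
  \<open>n\<close> is nearly 0 at \<open>x\<close> and hence at most \<open>1 + \<epsilon>\<close> in absolute value at \<open>x \<plusminus> e n\<close>.
\<close>

lemma almost_square_renorming:
  fixes Y :: "'a::real_normed_vector set" and e :: "nat \<Rightarrow> 'a" and g :: "nat \<Rightarrow> 'a \<Rightarrow> real"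
  assumes Y: "subspace Y" and lin: "\<And>n. linear (g n)"
    and C: "\<And>n x. \<bar>g n x\<bar> \<le> C * norm x"
    and e: "\<And>n. e n \<in> Y" and biorth: "\<And>n m. g n (e m) = (if n = m then 1 else 0)"
    and "K > 0" and K: "\<And>y M. y \<in> Y \<Longrightarrow> (\<And>n. \<bar>g n y\<bar> \<le> M) \<Longrightarrow> norm y \<le> K * M"
    and small: "\<And>A \<epsilon>. finite A \<Longrightarrow> \<epsilon> > 0 \<Longrightarrow> \<exists>n. \<forall>x\<in>A. \<bar>g n x\<bar> < \<epsilon>"
  shows "\<exists>p :: 'a \<Rightarrow> real. equivalent_norm p \<and> almost_square p"
proof -
  define p where "p x = max (infdist x Y) (SUP n. \<bar>g n x\<bar>)" for x
  have bdd: "bdd_above (range (\<lambda>n. \<bar>g n x\<bar>))" for x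
    using C by (intro bdd_aboveI2[of _ _ "C * norm x"])
  have p_le_iff: "p x \<le> r \<longleftrightarrow> infdist x Y \<le> r \<and> (\<forall>n. \<bar>g n x\<bar> \<le> r)" for x r
    unfolding p_def using bdd by (auto simp: cSUP_le_iff)
  have dist_le: "infdist x Y \<le> p x" and g_le: "\<bar>g n x\<bar> \<le> p x" for x n
    using p_le_iff[of x "p x"] by auto
  have "C \<ge> 0"
  proof -
    have "1 \<le> C * norm (e 0)" using C[of 0 "e 0"] biorth[of 0 0] by simp
    then show ?thesis by (metis mult_nonpos_nonneg norm_ge_zero not_le not_one_le_zero order_trans less_imp_le)
  qed
  have p_add: "p (x + z) \<le> p x + p z" for x z
    unfolding p_le_iff
  proof (intro conjI allI)
    show "infdist (x + z) Y \<le> p x + p z"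
      using infdist_subspace_add_le[OF Y, of x z] dist_le[of x] dist_le[of z] by simp
    show "\<bar>g n (x + z)\<bar> \<le> p x + p z" for n
      using g_le[of n x] g_le[of n z] by (simp add: linear_add[OF lin])
  qed
  have p_scale_le: "p (c *\<^sub>R x) \<le> \<bar>c\<bar> * p x" for c x
    unfolding p_le_iff using dist_le g_le
    by (auto simp: infdist_subspace_scale[OF Y] linear_scale[OF lin] abs_mult mult_left_mono)
  have p_scale: "p (c *\<^sub>R x) = \<bar>c\<bar> * p x" for c x
  proof (cases "c = 0")
    case True
    have "0 \<le> p 0" using g_le[of 0 0] by simp
    then show ?thesis using p_scale_le[of 0 x] True by simp
  next
    case False
    have "\<bar>c\<bar> * p x \<le> p (c *\<^sub>R x)"
      using p_scale_le[of "inverse c" "c *\<^sub>R x"] False by (simp add: field_simps)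
    with p_scale_le show ?thesis by (rule antisym)
  qed
  have upper: "p x \<le> (1 + C) * norm x" for x
  proof -
    have "infdist x Y \<le> norm x"
      using infdist_le[OF subspace_0[OF Y], of x] by simp
    moreover have "0 \<le> C * norm x" using \<open>C \<ge> 0\<close> by simp
    moreover have "\<bar>g n x\<bar> \<le> norm x + C * norm x" for n
      using C[of n x] by (simp add: add_increasing)
    ultimately show ?thesis unfolding p_le_iff by (simp add: distrib_right)
  qed
  \<comment> \<open>If \<open>p x < s\<close>, some \<open>y\<close> in \<open>Y\<close> has \<open>norm (x - y) < s\<close>; its coordinates are at most \<open>(1 + C) s\<close>, so
    \<open>norm y \<le> K (1 + C) s\<close>, and \<open>norm x\<close> is at most the sum of the two bounds.\<close>
  define L where "L = 1 + K * (1 + C)"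
  have "L > 0" using \<open>K > 0\<close> \<open>C \<ge> 0\<close> by (simp add: L_def add_pos_nonneg)
  have lower: "norm x \<le> L * p x" for x
  proof -
    have "norm x / L \<le> s" if s: "p x < s" for s
    proof -
      have "infdist x Y < s" using dist_le[of x] s by simp
      then obtain y where y: "y \<in> Y" "norm (x - y) < s"
        using infdist_lt_subspace_iff[OF Y] by blast
      have "\<bar>g n y\<bar> \<le> (1 + C) * s" for n
      proof -
        have "\<bar>g n y\<bar> \<le> \<bar>g n x\<bar> + \<bar>g n (x - y)\<bar>" by (simp add: linear_diff[OF lin])
        also have "\<dots> \<le> s + C * s"
          using g_le[of n x] s C[of n "x - y"] mult_left_mono[of "norm (x - y)" s C] y(2) \<open>C \<ge> 0\<close>
          by linarith
        finally show ?thesis by (simp add: algebra_simps)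
      qed
      from K[OF y(1) this] have "norm y \<le> K * ((1 + C) * s)" .
      then have "norm x \<le> L * s"
        using y(2) norm_triangle_sub[of x y] by (simp add: L_def algebra_simps)
      then show ?thesis using \<open>L > 0\<close> by (simp add: field_simps)
    qed
    then have "norm x / L \<le> p x" by (rule dense_ge)
    then show ?thesis using \<open>L > 0\<close> by (simp add: field_simps)
  qed
  have norm_p: "is_norm p"
    unfolding is_norm_def
  proof (intro conjI allI)
    show "p x = 0 \<longleftrightarrow> x = 0" for x
      using lower[of x] p_scale[of 0 0] by auto
  qed (use p_add p_scale in auto)
  have "1 / L * norm x \<le> p x" for x
    using lower[of x] \<open>L > 0\<close> by (simp add: field_simps)
  then have "\<forall>x. 1 / L * norm x \<le> p x \<and> p x \<le> (1 + C) * norm x"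
    using upper by blast
  moreover have "1 / L > 0" "1 + C > 0" using \<open>L > 0\<close> \<open>C \<ge> 0\<close> by auto
  ultimately have "equivalent_norm p"
    unfolding equivalent_norm_def using norm_p by blast
  moreover have "almost_square p"
  proof (rule almost_squareI[OF norm_p])
    fix A :: "'a set" and \<epsilon> :: real
    assume A: "finite A" "\<And>x. x \<in> A \<Longrightarrow> p x = 1" and "\<epsilon> > 0"
    obtain n where n: "\<And>x. x \<in> A \<Longrightarrow> \<bar>g n x\<bar> < \<epsilon>"
      using small[OF A(1) \<open>\<epsilon> > 0\<close>] by blast
    have dist_e: "infdist (e n) Y = 0" using e by simp
    have "p (e n) \<le> 1" unfolding p_le_iff using biorth dist_e by auto
    then have "p (e n) = 1" using g_le[of n "e n"] biorth[of n n] by simp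
    \<comment> \<open>The scalar \<open>c\<close> treats both signs at once.\<close>
    moreover have "p (x + c *\<^sub>R e n) \<le> 1 + \<epsilon>" if x: "x \<in> A" and c: "\<bar>c\<bar> = 1" for x c
      unfolding p_le_iff
    proof (intro conjI allI)
      show "infdist (x + c *\<^sub>R e n) Y \<le> 1 + \<epsilon>"
        using infdist_subspace_add_le[OF Y, of x "c *\<^sub>R e n"] infdist_subspace_scale[OF Y, of c "e n"]
          dist_e dist_le[of x] A(2)[OF x] \<open>\<epsilon> > 0\<close> by simp
      show "\<bar>g m (x + c *\<^sub>R e n)\<bar> \<le> 1 + \<epsilon>" for m
        using n[OF x] g_le[of m x] A(2)[OF x] \<open>\<epsilon> > 0\<close> c
        by (cases "m = n") (auto simp: linear_add[OF lin] linear_scale[OF lin] biorth)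
    qed
    from this[of _ 1] this[of _ "- 1"]
    have "\<forall>x\<in>A. p (x + e n) \<le> 1 + \<epsilon> \<and> p (x - e n) \<le> 1 + \<epsilon>" by simp
    ultimately show "\<exists>y. p y = 1 \<and> (\<forall>x\<in>A. p (x + y) \<le> 1 + \<epsilon> \<and> p (x - y) \<le> 1 + \<epsilon>)" by blast
  qed
  ultimately show ?thesis by blast
qed

text \<open>
  The extensions \<open>h n\<close> are corrected by their pointwise limit \<open>h'\<close>, which is invisible on \<open>Y\<close>; the
  correction costs a factor 2 in the norm bound and makes them cluster at 0.
\<close>

theorem theorem2p3:
  fixes Y :: "'a::banach set"
  assumes "subspace Y" and "closed Y" and "linearly_homeomorphic c0 Y"
  shows "\<exists>p :: 'a \<Rightarrow> real. equivalent_norm p \<and> almost_square p"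
proof -
  obtain e :: "nat \<Rightarrow> 'a" and h C K where
    "K > 0" and h_lin: "\<And>n. linear (h n)" and h_bound: "\<And>n x. \<bar>h n x\<bar> \<le> C * norm x"
    and e: "\<And>n. e n \<in> Y" and biorth: "\<And>n m. h n (e m) = (if n = m then 1 else 0)"
    and h_null: "\<And>y. y \<in> Y \<Longrightarrow> (\<lambda>n. h n y) \<longlonglongrightarrow> 0"
    and K: "\<And>y M. y \<in> Y \<Longrightarrow> (\<And>n. \<bar>h n y\<bar> \<le> M) \<Longrightarrow> norm y \<le> K * M"
    using c0_copy_coordinates[OF assms(1,3)] by metis
  obtain G h' where G: "G \<le> sequentially" "G \<noteq> bot" and lim: "\<And>x. ((\<lambda>n. h n x) \<longlongrightarrow> h' x) G"
    using pointwise_bounded_imp_convergent_subfilter[of h, OF h_bound] by blast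
  have h'_lin: "linear h'" using linear_of_pointwise_limit[OF G(2) lim h_lin] .
  have h'_Y: "h' y = 0" if "y \<in> Y" for y
    using tendsto_unique[OF G(2) lim tendsto_mono[OF G(1) h_null[OF that]]] .
  have h'_bound: "\<bar>h' x\<bar> \<le> C * norm x" for x
    using tendsto_upperbound[OF tendsto_rabs[OF lim] _ G(2)] h_bound by simp
  define g where "g n x = h n x - h' x" for n x
  have g_Y: "g n y = h n y" if "y \<in> Y" for n y using h'_Y[OF that] by (simp add: g_def)
  show ?thesis
  proof (rule almost_square_renorming[of Y g "2 * C" e K])
    show "linear (g n)" for n
      unfolding g_def by (intro linear_compose_sub h_lin h'_lin)
    show "\<bar>g n x\<bar> \<le> 2 * C * norm x" for n x
      using h_bound[of n x] h'_bound[of x] by (simp add: g_def)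
    show "\<exists>n. \<forall>x\<in>A. \<bar>g n x\<bar> < \<epsilon>" if "finite A" "\<epsilon> > 0" for A :: "'a set" and \<epsilon>
    proof -
      have "\<forall>\<^sub>F n in G. \<bar>g n x\<bar> < \<epsilon>" for x
        using tendstoD[OF lim \<open>\<epsilon> > 0\<close>, of x] by (simp add: g_def dist_real_def)
      then have "\<forall>\<^sub>F n in G. \<forall>x\<in>A. \<bar>g n x\<bar> < \<epsilon>"
        using \<open>finite A\<close> by (simp add: eventually_ball_finite_distrib)
      then show ?thesis using eventually_happens' G(2) by blast
    qed
  qed (use assms(1) e biorth \<open>K > 0\<close> K g_Y in auto)
qed

end
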